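(* Let $1 < p \leq s \leq q < \infty$, and consider the real Banach spaces $\ell_s \oplus_p \ell_p$ and $\ell_s \oplus_q \ell_q$. Then $$\overline{\delta}_{\ell_s \oplus_p \ell_p}(t) = \overline{\rho}_{\ell_s \oplus_q \ell_q}(t) = (1 + t^s)^{\frac{1}{s}} - 1$$ for every $t > 0$. In particular, $\overline{\rho}_{\ell_s \oplus_q \ell_q}(t) > t - 1$ for every $t > 1$.
   Context: $X\oplus_p Y$ denotes the direct sum with norm $\|(x,y)\|=(\|x\|^p+\|y\|^p)^{1/p}$. For a real (infinite dimensional) Banach space $E$ with unit sphere $S_E$, $t>0$ and $x\in S_E$, put $$\overline{\delta}_E (t, x) := \sup_{\dim(E/F) < \infty}\ \inf_{y \in S_F} \|x + ty\| - 1, \qquad \overline{\rho}_E (t, x):= \inf_{\dim(E/F) < \infty}\ \sup_{y \in S_F} \|x + ty\| - 1,$$ where $F$ ranges over the (closed) finite codimensional subspaces of $E$. The modulus of asymptotic uniform convexity of $E$ is $\overline{\delta}_E(t) = \inf_{x \in S_E} \overline{\delta}_E (t, x)$, and the modulus of asymptotic uniform smoothness of $E$ is $\overline{\rho}_E(t) = \sup_{x \in S_E} \overline{\rho}_E(t, x)$. *)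

theory Defs
  imports "HOL-Analysis.Analysis" "HOL-Library.Function_Algebras"
begin

text \<open>
  The spaces \<open>\<ell>\<^sub>s\<close> depend on a real parameter, so they cannot be types.  A normed space is
  therefore given by a linear subspace of an ambient real vector space together with a norm,
  whose values outside the subspace are irrelevant.
\<close>

record 'a nspace =
  pts :: "'a set"
  nrm :: "'a \<Rightarrow> real"

instantiation "fun" :: (type, real_vector) real_vector
begin

definition scaleR_fun :: "real \<Rightarrow> ('a \<Rightarrow> 'b) \<Rightarrow> 'a \<Rightarrow> 'b"
  where "scaleR_fun c f = (\<lambda>x. c *\<^sub>R f x)"

instance
  by standard (simp_all add: scaleR_fun_def plus_fun_def fun_eq_iff algebra_simps)

end

definition ell :: "real \<Rightarrow> (nat \<Rightarrow> real) nspace"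
  where "ell s = \<lparr>pts = {x. summable (\<lambda>n. \<bar>x n\<bar> powr s)},
                  nrm = (\<lambda>x. (\<Sum>n. \<bar>x n\<bar> powr s) powr (1 / s))\<rparr>"

definition direct_sum :: "real \<Rightarrow> 'a nspace \<Rightarrow> 'b nspace \<Rightarrow> ('a \<times> 'b) nspace"
  where "direct_sum p X Y = \<lparr>pts = pts X \<times> pts Y,
                             nrm = (\<lambda>z. (nrm X (fst z) powr p + nrm Y (snd z) powr p) powr (1 / p))\<rparr>"

definition unit_sphere :: "'a::real_vector nspace \<Rightarrow> 'a set \<Rightarrow> 'a set"
  where "unit_sphere E F = {x \<in> F. nrm E x = 1}"

definition norm_topology :: "'a::real_vector nspace \<Rightarrow> 'a topology"
  where "norm_topology E = Metric_space.mtopology (pts E) (\<lambda>x y. nrm E (x - y))"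

text \<open>The last conjunct says that finitely many cosets span \<open>E/F\<close>, i.e. \<open>dim (E/F) < \<infinity>\<close>.\<close>

definition fin_codim :: "'a::real_vector nspace \<Rightarrow> 'a set \<Rightarrow> bool"
  where "fin_codim E F \<longleftrightarrow>
    subspace F \<and> F \<subseteq> pts E \<and> closedin (norm_topology E) F \<and>
    (\<exists>B. finite B \<and> B \<subseteq> pts E \<and> (\<forall>x\<in>pts E. \<exists>b\<in>span B. x - b \<in> F))"

text \<open>
  All suprema and infima below are of real numbers.  If \<open>E\<close> is an infinite-dimensional normed
  space, then they are over nonempty bounded sets, since \<open>\<bar>1 - t\<bar> \<le> \<parallel>x + t y\<parallel> \<le> 1 + t\<close> for unit
  vectors \<open>x\<close>, \<open>y\<close> and \<open>t > 0\<close>, and a subspace of finite codimension contains unit vectors.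
\<close>

definition auc_at :: "'a::real_vector nspace \<Rightarrow> real \<Rightarrow> 'a \<Rightarrow> real"
  where "auc_at E t x =
    (SUP F\<in>{F. fin_codim E F}. INF y\<in>unit_sphere E F. nrm E (x + t *\<^sub>R y)) - 1"

definition aus_at :: "'a::real_vector nspace \<Rightarrow> real \<Rightarrow> 'a \<Rightarrow> real"
  where "aus_at E t x =
    (INF F\<in>{F. fin_codim E F}. SUP y\<in>unit_sphere E F. nrm E (x + t *\<^sub>R y)) - 1"

definition auc_modulus :: "'a::real_vector nspace \<Rightarrow> real \<Rightarrow> real"
  where "auc_modulus E t = (INF x\<in>unit_sphere E (pts E). auc_at E t x)"

definition aus_modulus :: "'a::real_vector nspace \<Rightarrow> real \<Rightarrow> real"
  where "aus_modulus E t = (SUP x\<in>unit_sphere E (pts E). aus_at E t x)"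

end

theory Submission
  imports Defs
begin

text \<open>
  Up to \<open>\<epsilon>\<close>, a unit vector \<open>x\<close> is supported in finitely many coordinates, so it is disjoint from all
  vectors of a tail subspace, which has finite codimension.  For disjointly supported \<open>x\<close> and \<open>z\<close>
  Minkowski's inequality in dimension two gives \<open>\<parallel>x + z\<parallel>\<^sup>s \<ge> \<parallel>x\<parallel>\<^sup>s + \<parallel>z\<parallel>\<^sup>s\<close> in the \<open>p\<close>-sum (as \<open>s / p \<ge> 1\<close>)
  and the reverse inequality in the \<open>q\<close>-sum (as \<open>s / q \<le> 1\<close>).  Both bounds are attained at
  \<open>x = (e\<^sub>0, 0)\<close>: counting dimensions, every subspace of finite codimension contains a unit vector
  \<open>(a, 0)\<close> with \<open>a\<close> finitely supported and \<open>a 0 = 0\<close>.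
\<close>

section \<open>Minkowski's inequality\<close>

text \<open>\<open>powr_convex\<close> settles the case where \<open>x\<close> and \<open>y\<close>
  are both positive. If one of them is 0, the claim reduces to \<open>k powr s \<le> k\<close> for
  \<open>k\<close> between 0 and 1, which is what \<open>small\<close> provides.\<close>

lemma powr_convex_comb_le:
  fixes x y s :: real
  assumes s: "1 \<le> s" and "0 \<le> x" "0 \<le> y" and l: "0 \<le> l" "0 \<le> m" "l + m = 1"
  shows "(l * x + m * y) powr s \<le> l * x powr s + m * y powr s"
proof -
  have small: "(k * z) powr s \<le> k * z powr s" if "0 \<le> k" "k \<le> 1" "0 \<le> z" for k z :: real
  proof -
    have "k powr s \<le> k powr 1" using that s by (intro powr_mono') auto
    then have "k powr s \<le> k" using that by auto
    then show ?thesis using that by (simp add: powr_mult mult_right_mono)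
  qed
  show ?thesis
  proof (cases "x = 0 \<or> y = 0")
    case True
    then show ?thesis using small[of l x] small[of m y] assms by auto
  next
    case False
    then have "x > 0" "y > 0" using assms by auto
    then show ?thesis
      using powr_convex[OF s] l unfolding convex_on_def by auto
  qed
qed

text \<open>The convexity inequality behind Minkowski's inequality, where \<open>\<alpha>\<close> and \<open>\<beta>\<close> are to be the norms of
  the two summands.\<close>

lemma powr_add_le_weighted:
  fixes x y s \<alpha> \<beta> :: real
  assumes s: "1 \<le> s" and xy: "0 \<le> x" "0 \<le> y" and pos: "0 < \<alpha>" "0 < \<beta>"
  shows "(x + y) powr s \<le> (\<alpha> + \<beta>) powr s *
    (\<alpha> / (\<alpha> + \<beta>) * (x powr s / \<alpha> powr s) + \<beta> / (\<alpha> + \<beta>) * (y powr s / \<beta> powr s))"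
proof -
  have "x + y = (\<alpha> + \<beta>) * (\<alpha> / (\<alpha> + \<beta>) * (x / \<alpha>) + \<beta> / (\<alpha> + \<beta>) * (y / \<beta>))"
    using pos by (simp add: distrib_left)
  then have "(x + y) powr s =
      (\<alpha> + \<beta>) powr s * (\<alpha> / (\<alpha> + \<beta>) * (x / \<alpha>) + \<beta> / (\<alpha> + \<beta>) * (y / \<beta>)) powr s"
    using pos xy by (metis powr_mult)
  also have "\<dots> \<le> (\<alpha> + \<beta>) powr s *
      (\<alpha> / (\<alpha> + \<beta>) * (x / \<alpha>) powr s + \<beta> / (\<alpha> + \<beta>) * (y / \<beta>) powr s)"
    using s xy pos
    by (intro mult_left_mono powr_convex_comb_le) (auto simp: add_divide_distrib[symmetric])
  finally show ?thesis using xy pos by (simp add: powr_divide)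
qed

section \<open>The normed spaces \<open>ell s\<close> and their direct sums\<close>

locale normed_nspace =
  fixes E :: "'a::real_vector nspace"
  assumes subspace_pts: "subspace (pts E)"
    and nrm_nonneg: "0 \<le> nrm E x"
    \<comment> \<open>also outside \<open>pts E\<close>, since \<open>Metric_space\<close> wants a distance symmetric on the whole type\<close>
    and nrm_uminus: "nrm E (- x) = nrm E x"
    and nrm_eq_0D: "x \<in> pts E \<Longrightarrow> nrm E x = 0 \<Longrightarrow> x = 0"
    and nrm_scaleR: "x \<in> pts E \<Longrightarrow> nrm E (c *\<^sub>R x) = \<bar>c\<bar> * nrm E x"
    and nrm_triangle: "x \<in> pts E \<Longrightarrow> y \<in> pts E \<Longrightarrow> nrm E (x + y) \<le> nrm E x + nrm E y"
begin

lemma nrm_0: "nrm E 0 = 0"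
  using nrm_scaleR[of 0 0] subspace_pts by (simp add: subspace_0)

lemma nrm_minus_commute: "nrm E (x - y) = nrm E (y - x)"
  using nrm_uminus[of "x - y"] by simp

lemma nrm_diff_le:
  assumes "x \<in> pts E" "y \<in> pts E"
  shows "nrm E x \<le> nrm E y + nrm E (x - y)"
  using nrm_triangle[of y "x - y"] assms subspace_pts by (simp add: subspace_diff)

text \<open>This is the metric behind \<open>norm_topology\<close>, so closedness can be tested with
  \<open>closedin_metric\<close> and \<open>mball\<close>.\<close>

sublocale Metric_space "pts E" "\<lambda>x y. nrm E (x - y)"
proof
  fix x y z
  show "0 \<le> nrm E (x - y)" by (rule nrm_nonneg)
  show "nrm E (x - y) = nrm E (y - x)" by (rule nrm_minus_commute)
  assume *: "x \<in> pts E" "y \<in> pts E"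
  show "nrm E (x - y) = 0 \<longleftrightarrow> x = y"
    using nrm_eq_0D[of "x - y"] * subspace_pts by (auto simp: nrm_0 subspace_diff)
  assume "z \<in> pts E"
  then show "nrm E (x - z) \<le> nrm E (x - y) + nrm E (y - z)"
    using nrm_triangle[of "x - y" "y - z"] * subspace_pts by (simp add: subspace_diff)
qed

end

lemma scaleR_fun_apply [simp]: "(c *\<^sub>R f) x = c *\<^sub>R f x"
  by (simp add: scaleR_fun_def)

lemma mem_pts_ell: "x \<in> pts (ell s) \<longleftrightarrow> summable (\<lambda>n. \<bar>x n\<bar> powr s)"
  by (simp add: ell_def)

lemma nrm_ell: "nrm (ell s) x = (\<Sum>n. \<bar>x n\<bar> powr s) powr (1 / s)"
  by (simp add: ell_def)

lemma nrm_ell_powr: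
  assumes "0 < s" "x \<in> pts (ell s)"
  shows "nrm (ell s) x powr s = (\<Sum>n. \<bar>x n\<bar> powr s)"
  using assms by (simp add: nrm_ell powr_powr mem_pts_ell suminf_nonneg)

text \<open>One term of a nonnegative series is at most its sum. The bound yields definiteness of
  the norm and, later, closedness of the tail subspaces.\<close>

lemma abs_nth_le_nrm_ell:
  assumes "0 < s" "x \<in> pts (ell s)"
  shows "\<bar>x n\<bar> \<le> nrm (ell s) x"
proof -
  have "\<bar>x n\<bar> powr s \<le> (\<Sum>n. \<bar>x n\<bar> powr s)"
    using sum_le_suminf[of "\<lambda>n. \<bar>x n\<bar> powr s" "{n}"] assms by (auto simp: mem_pts_ell)
  then have "(\<bar>x n\<bar> powr s) powr (1 / s) \<le> nrm (ell s) x"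
    unfolding nrm_ell using assms by (intro powr_mono2) auto
  then show ?thesis using assms by (simp add: powr_powr)
qed

lemma nrm_ell_eq_0D: "0 < s \<Longrightarrow> x \<in> pts (ell s) \<Longrightarrow> nrm (ell s) x = 0 \<Longrightarrow> x = 0"
  using abs_nth_le_nrm_ell[of s x] by (auto simp: fun_eq_iff)

text \<open>One majorant serves both claims: \<open>powr_add_le_weighted\<close> is summed over all
  coordinates, with the two norms as \<alpha> and \<beta>. The normalised series contribute
  \<open>?a / (?a + ?b)\<close> and \<open>?b / (?a + ?b)\<close>, so the total is
  \<open>(?a + ?b) powr s\<close>. A zero norm is treated apart because the majorant divides by
  it.\<close>

lemma ell_add:
  assumes s: "1 \<le> s" and x: "x \<in> pts (ell s)" and y: "y \<in> pts (ell s)"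
  shows "x + y \<in> pts (ell s)" and "nrm (ell s) (x + y) \<le> nrm (ell s) x + nrm (ell s) y"
proof -
  have s0: "0 < s" using s by simp
  let ?a = "nrm (ell s) x" and ?b = "nrm (ell s) y"
  have nonneg: "0 \<le> ?a" "0 \<le> ?b" by (auto simp: nrm_ell)
  have "x + y \<in> pts (ell s) \<and> nrm (ell s) (x + y) \<le> ?a + ?b"
  proof (cases "?a = 0 \<or> ?b = 0")
    case True
    then have "x = 0 \<or> y = 0" using nrm_ell_eq_0D s0 x y by blast
    then show ?thesis using x y nonneg by (auto simp: plus_fun_def zero_fun_def)
  next
    case False
    then have pos: "0 < ?a" "0 < ?b" using nonneg by auto
    let ?g = "\<lambda>n. (?a + ?b) powr s * (?a / (?a + ?b) * (\<bar>x n\<bar> powr s / ?a powr s)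
        + ?b / (?a + ?b) * (\<bar>y n\<bar> powr s / ?b powr s))"
    have sx: "(\<lambda>n. \<bar>x n\<bar> powr s) sums (?a powr s)" and sy: "(\<lambda>n. \<bar>y n\<bar> powr s) sums (?b powr s)"
      using x y s0 by (auto simp: mem_pts_ell nrm_ell_powr summable_sums)
    have "?g sums ((?a + ?b) powr s * (?a / (?a + ?b) * (?a powr s / ?a powr s)
        + ?b / (?a + ?b) * (?b powr s / ?b powr s)))"
      by (intro sums_mult sums_add sums_divide sx sy)
    also have "(?a + ?b) powr s * (?a / (?a + ?b) * (?a powr s / ?a powr s)
        + ?b / (?a + ?b) * (?b powr s / ?b powr s)) = (?a + ?b) powr s"
      using pos by (simp add: add_divide_distrib[symmetric])
    finally have g: "?g sums ((?a + ?b) powr s)" .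
    have le: "\<bar>(x + y) n\<bar> powr s \<le> ?g n" for n
    proof -
      have "\<bar>(x + y) n\<bar> powr s \<le> (\<bar>x n\<bar> + \<bar>y n\<bar>) powr s"
        using s0 by (intro powr_mono2) auto
      also have "\<dots> \<le> ?g n" using pos s by (intro powr_add_le_weighted) auto
      finally show ?thesis .
    qed
    have mem: "x + y \<in> pts (ell s)"
      unfolding mem_pts_ell using le g
      by (intro summable_comparison_test'[OF sums_summable[OF g], of 0]) auto
    have "(\<Sum>n. \<bar>(x + y) n\<bar> powr s) \<le> (?a + ?b) powr s"
      using sums_le[OF le summable_sums g] mem by (simp add: mem_pts_ell)
    then have "nrm (ell s) (x + y) \<le> ((?a + ?b) powr s) powr (1 / s)"
      unfolding nrm_ell[of s "x + y"] using s0 mem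
      by (intro powr_mono2) (auto simp: mem_pts_ell suminf_nonneg)
    then show ?thesis using mem s0 pos by (simp add: powr_powr)
  qed
  then show "x + y \<in> pts (ell s)" "nrm (ell s) (x + y) \<le> ?a + ?b" by auto
qed

lemma ell_scaleR:
  assumes "0 < s" "x \<in> pts (ell s)"
  shows "c *\<^sub>R x \<in> pts (ell s)" and "nrm (ell s) (c *\<^sub>R x) = \<bar>c\<bar> * nrm (ell s) x"
  using assms
  by (auto simp: mem_pts_ell nrm_ell abs_mult powr_mult suminf_mult powr_powr suminf_nonneg)

lemma normed_nspace_ell:
  assumes "1 \<le> s"
  shows "normed_nspace (ell s)"
proof
  show "subspace (pts (ell s))"
    using assms by (auto simp: subspace_def ell_add ell_scaleR mem_pts_ell[of 0])
  show "0 \<le> nrm (ell s) x" "nrm (ell s) (- x) = nrm (ell s) x" for x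
    by (simp_all add: nrm_ell)
  show "x = 0" if "x \<in> pts (ell s)" "nrm (ell s) x = 0" for x
    using nrm_ell_eq_0D[OF _ that] assms by simp
qed (use assms in \<open>auto simp: ell_add ell_scaleR\<close>)

lemma nrm_ell_add_disjoint:
  assumes s: "0 < s" and xy: "x \<in> pts (ell s)" "y \<in> pts (ell s)"
    and disj: "\<And>n. x n = 0 \<or> y n = 0"
  shows "nrm (ell s) (x + y) powr s = nrm (ell s) x powr s + nrm (ell s) y powr s"
proof -
  have eq: "\<bar>(x + y) n\<bar> powr s = \<bar>x n\<bar> powr s + \<bar>y n\<bar> powr s" for n
    using disj[of n] by auto
  then have "x + y \<in> pts (ell s)"
    using xy by (simp only: mem_pts_ell summable_add)
  then show ?thesis
    using xy s eq by (simp add: nrm_ell_powr suminf_add mem_pts_ell)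
qed

text \<open>This is the triangle inequality of \<open>ell p\<close> for sequences supported on the
  first two coordinates. It gives the triangle inequality of a direct sum and, with other exponents,
  the mixed estimates for disjoint supports.\<close>

lemma minkowski_two:
  fixes a b c d p :: real
  assumes p: "1 \<le> p" and nonneg: "0 \<le> a" "0 \<le> b" "0 \<le> c" "0 \<le> d"
  shows "((a + c) powr p + (b + d) powr p) powr (1 / p)
    \<le> (a powr p + b powr p) powr (1 / p) + (c powr p + d powr p) powr (1 / p)"
proof -
  define v :: "real \<Rightarrow> real \<Rightarrow> nat \<Rightarrow> real"
    where "v = (\<lambda>x y n. if n = 0 then x else if n = 1 then y else 0)"
  have sums: "(\<lambda>n. \<bar>v x y n\<bar> powr p) sums (x powr p + y powr p)" if "0 \<le> x" "0 \<le> y" for x y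
    using sums_finite[of "{0, 1}" "\<lambda>n. \<bar>v x y n\<bar> powr p"] that by (simp add: v_def)
  then have mem: "v x y \<in> pts (ell p)"
    and nrm: "nrm (ell p) (v x y) = (x powr p + y powr p) powr (1 / p)"
    if "0 \<le> x" "0 \<le> y" for x y
    using that by (auto simp: mem_pts_ell nrm_ell sums_iff)
  have "v (a + c) (b + d) = v a b + v c d" by (auto simp: v_def)
  then show ?thesis
    using ell_add(2)[OF p mem mem, of a b c d] nonneg by (simp add: nrm flip: \<open>v (a + c) (b + d) = v a b + v c d\<close>)
qed

lemma mem_pts_direct_sum:
  "z \<in> pts (direct_sum p X Y) \<longleftrightarrow> fst z \<in> pts X \<and> snd z \<in> pts Y"
  by (auto simp: direct_sum_def mem_Times_iff)

lemma nrm_direct_sum: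
  "nrm (direct_sum p X Y) z = (nrm X (fst z) powr p + nrm Y (snd z) powr p) powr (1 / p)"
  by (simp add: direct_sum_def)

lemma normed_nspace_direct_sum:
  assumes p: "1 \<le> p" and "normed_nspace X" and "normed_nspace Y"
  shows "normed_nspace (direct_sum p X Y)"
proof -
  interpret X: normed_nspace X by fact
  interpret Y: normed_nspace Y by fact
  show ?thesis
  proof
    show "subspace (pts (direct_sum p X Y))"
      using X.subspace_pts Y.subspace_pts by (auto simp: subspace_def mem_pts_direct_sum)
    fix x y :: "'a \<times> 'b" and c :: real
    show "0 \<le> nrm (direct_sum p X Y) x" by (simp add: nrm_direct_sum)
    show "nrm (direct_sum p X Y) (- x) = nrm (direct_sum p X Y) x"
      by (simp add: nrm_direct_sum X.nrm_uminus Y.nrm_uminus)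
    assume x: "x \<in> pts (direct_sum p X Y)"
    show "x = 0" if "nrm (direct_sum p X Y) x = 0"
      using that x X.nrm_eq_0D[of "fst x"] Y.nrm_eq_0D[of "snd x"]
      by (auto simp: nrm_direct_sum mem_pts_direct_sum add_nonneg_eq_0_iff prod_eq_iff)
    have "nrm (direct_sum p X Y) (c *\<^sub>R x) =
        (\<bar>c\<bar> powr p * (nrm X (fst x) powr p + nrm Y (snd x) powr p)) powr (1 / p)"
      using x by (simp add: nrm_direct_sum mem_pts_direct_sum X.nrm_scaleR Y.nrm_scaleR
          X.nrm_nonneg Y.nrm_nonneg powr_mult distrib_left)
    then show "nrm (direct_sum p X Y) (c *\<^sub>R x) = \<bar>c\<bar> * nrm (direct_sum p X Y) x"
      using p by (simp add: nrm_direct_sum powr_mult powr_powr)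
    assume y: "y \<in> pts (direct_sum p X Y)"
    have "nrm (direct_sum p X Y) (x + y) \<le>
        ((nrm X (fst x) + nrm X (fst y)) powr p + (nrm Y (snd x) + nrm Y (snd y)) powr p) powr (1 / p)"
      unfolding nrm_direct_sum using p x y
      by (intro powr_mono2 add_mono)
        (auto simp: mem_pts_direct_sum X.nrm_triangle Y.nrm_triangle X.nrm_nonneg Y.nrm_nonneg)
    also have "\<dots> \<le> nrm (direct_sum p X Y) x + nrm (direct_sum p X Y) y"
      unfolding nrm_direct_sum using p
      by (intro minkowski_two) (auto simp: X.nrm_nonneg Y.nrm_nonneg)
    finally show "nrm (direct_sum p X Y) (x + y)
        \<le> nrm (direct_sum p X Y) x + nrm (direct_sum p X Y) y" .
  qed
qed

section \<open>Estimates for vectors with disjoint supports\<close>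

text \<open>Minkowski's inequality with exponent \<open>1 / r \<ge> 1\<close>, applied to the pairs
  of \<open>r\<close>-th powers of \<open>(a, c)\<close> and \<open>(b, d)\<close>, becomes the
  reverse inequality for exponent \<open>r\<close>.\<close>

lemma minkowski_two_reverse:
  fixes a b c d r :: real
  assumes r: "0 < r" "r \<le> 1" and nonneg: "0 \<le> a" "0 \<le> b" "0 \<le> c" "0 \<le> d"
  shows "(a powr r + b powr r) powr (1 / r) + (c powr r + d powr r) powr (1 / r)
    \<le> ((a + c) powr r + (b + d) powr r) powr (1 / r)"
proof -
  have "((a powr r + b powr r) powr (1 / r) + (c powr r + d powr r) powr (1 / r)) powr r
      \<le> (a + c) powr r + (b + d) powr r"
    using minkowski_two[of "1 / r" "a powr r" "c powr r" "b powr r" "d powr r"] r nonneg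
    by (simp add: powr_powr)
  then have "(((a powr r + b powr r) powr (1 / r) + (c powr r + d powr r) powr (1 / r)) powr r)
      powr (1 / r) \<le> ((a + c) powr r + (b + d) powr r) powr (1 / r)"
    using r by (intro powr_mono2) auto
  then show ?thesis using r by (simp add: powr_powr)
qed

text \<open>Minkowski's inequality for the sum of \<open>(a\<^sup>p, c\<^sup>p)\<close>, \<open>(b\<^sup>p, 0)\<close> and \<open>(0, d\<^sup>p)\<close>, with exponent \<open>s / p\<close>.\<close>

lemma mixed_norm_lower:
  fixes a b c d p s :: real
  assumes ps: "0 < p" "p \<le> s" and nonneg: "0 \<le> a" "0 \<le> b" "0 \<le> c" "0 \<le> d"
  shows "((a powr p + b powr p) powr (s / p) + (c powr p + d powr p) powr (s / p)) powr (1 / s)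
    \<le> ((a powr s + c powr s) powr (p / s) + (b powr p + d powr p)) powr (1 / p)"
proof -
  have r: "1 \<le> s / p" and s0: "0 < s" using ps by auto
  have "((a powr p + b powr p) powr (s / p) + (c powr p + d powr p) powr (s / p)) powr (p / s)
      \<le> ((a powr p + b powr p) powr (s / p) + (c powr p) powr (s / p)) powr (p / s) + d powr p"
    using minkowski_two[OF r, of "a powr p + b powr p" "c powr p" 0 "d powr p"] s0 ps
    by (simp add: powr_powr)
  also have "\<dots> \<le> (a powr s + c powr s) powr (p / s) + (b powr p + d powr p)"
    using minkowski_two[OF r, of "a powr p" "c powr p" "b powr p" 0] s0 ps
    by (simp add: powr_powr)
  finally have "(((a powr p + b powr p) powr (s / p) + (c powr p + d powr p) powr (s / p)) powr (p / s))
      powr (1 / p) \<le> ((a powr s + c powr s) powr (p / s) + (b powr p + d powr p)) powr (1 / p)"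
    using ps by (intro powr_mono2) auto
  then show ?thesis using ps by (simp add: powr_powr)
qed

text \<open>The same decomposition as in \<open>mixed_norm_lower\<close>, now with exponent
  \<open>s / q \<le> 1\<close>, for which Minkowski's inequality is reversed:
  \<open>(b powr q, 0)\<close> is absorbed first, then \<open>(0, d powr q)\<close>. Here
  \<open>a\<close>, \<open>b\<close> stand for the component norms of one vector and
  \<open>c\<close>, \<open>d\<close> for those of the other.\<close>

lemma mixed_norm_upper:
  fixes a b c d q s :: real
  assumes sq: "0 < s" "s \<le> q" and nonneg: "0 \<le> a" "0 \<le> b" "0 \<le> c" "0 \<le> d"
  shows "((a powr s + c powr s) powr (q / s) + (b powr q + d powr q)) powr (1 / q)
    \<le> ((a powr q + b powr q) powr (s / q) + (c powr q + d powr q) powr (s / q)) powr (1 / s)"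
proof -
  have r: "0 < s / q" "s / q \<le> 1" and q0: "0 < q" using sq by auto
  have "(a powr s + c powr s) powr (q / s) + (b powr q + d powr q)
      \<le> ((a powr q + b powr q) powr (s / q) + (c powr q) powr (s / q)) powr (q / s) + d powr q"
    using minkowski_two_reverse[OF r, of "a powr q" "c powr q" "b powr q" 0] q0 sq
    by (simp add: powr_powr)
  also have "\<dots> \<le> ((a powr q + b powr q) powr (s / q) + (c powr q + d powr q) powr (s / q)) powr (q / s)"
    using minkowski_two_reverse[OF r, of "a powr q + b powr q" "c powr q" 0 "d powr q"] q0 sq
    by (simp add: powr_powr)
  finally have "((a powr s + c powr s) powr (q / s) + (b powr q + d powr q)) powr (1 / q) \<le>
      (((a powr q + b powr q) powr (s / q) + (c powr q + d powr q) powr (s / q)) powr (q / s)) powr (1 / q)"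
    using q0 by (intro powr_mono2) auto
  then show ?thesis using q0 by (simp add: powr_powr)
qed

definition disjoint_supp :: "(nat \<Rightarrow> real) \<times> (nat \<Rightarrow> real) \<Rightarrow> (nat \<Rightarrow> real) \<times> (nat \<Rightarrow> real) \<Rightarrow> bool"
  where "disjoint_supp x y \<longleftrightarrow>
    (\<forall>n. (fst x n = 0 \<or> fst y n = 0) \<and> (snd x n = 0 \<or> snd y n = 0))"

text \<open>For disjoint supports \<open>s\<close>-th powers add in the first component and
  \<open>r\<close>-th powers in the second. The result has the shape that
  \<open>mixed_norm_lower\<close> and \<open>mixed_norm_upper\<close> compare.\<close>

lemma nrm_direct_sum_ell_add_disjoint:
  assumes sr: "0 < s" "0 < r" and disj: "disjoint_supp x y"
    and xy: "x \<in> pts (direct_sum r (ell s) (ell r))" "y \<in> pts (direct_sum r (ell s) (ell r))"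
  shows "nrm (direct_sum r (ell s) (ell r)) (x + y) =
    ((nrm (ell s) (fst x) powr s + nrm (ell s) (fst y) powr s) powr (r / s) +
     (nrm (ell r) (snd x) powr r + nrm (ell r) (snd y) powr r)) powr (1 / r)"
proof -
  have "nrm (ell s) (fst x + fst y) powr r = (nrm (ell s) (fst x + fst y) powr s) powr (r / s)"
    using sr by (simp add: powr_powr)
  then show ?thesis
    using sr disj xy by (simp add: nrm_direct_sum mem_pts_direct_sum disjoint_supp_def nrm_ell_add_disjoint)
qed

lemma nrm_direct_sum_powr:
  assumes "0 < r"
  shows "nrm (direct_sum r X Y) z powr s = (nrm X (fst z) powr r + nrm Y (snd z) powr r) powr (s / r)"
  by (simp add: nrm_direct_sum powr_powr)

lemma nrm_add_disjoint_lower: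
  assumes ps: "0 < p" "p \<le> s" and disj: "disjoint_supp x y"
    and xy: "x \<in> pts (direct_sum p (ell s) (ell p))" "y \<in> pts (direct_sum p (ell s) (ell p))"
  defines "N \<equiv> nrm (direct_sum p (ell s) (ell p))"
  shows "(N x powr s + N y powr s) powr (1 / s) \<le> N (x + y)"
  unfolding N_def nrm_direct_sum_powr[OF ps(1)]
  using mixed_norm_lower[OF ps] ps disj xy
  by (subst nrm_direct_sum_ell_add_disjoint) (auto simp: nrm_ell)

lemma nrm_add_disjoint_upper:
  assumes sq: "0 < s" "s \<le> q" and disj: "disjoint_supp x y"
    and xy: "x \<in> pts (direct_sum q (ell s) (ell q))" "y \<in> pts (direct_sum q (ell s) (ell q))"
  defines "N \<equiv> nrm (direct_sum q (ell s) (ell q))"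
  shows "N (x + y) \<le> (N x powr s + N y powr s) powr (1 / s)"
  unfolding N_def nrm_direct_sum_powr[OF order.strict_trans2[OF sq]]
  using mixed_norm_upper[OF sq] sq disj xy
  by (subst nrm_direct_sum_ell_add_disjoint) (auto simp: nrm_ell)

section \<open>Subspaces of finite codimension\<close>

text \<open>Dimension count: send each \<open>w\<close> to a representative of its coset in
  \<open>span B\<close> and extend linearly to \<open>g\<close>. Since \<open>y - g y\<close> stays
  in \<open>F\<close> for \<open>y\<close> in \<open>span W\<close>, the kernel of \<open>g\<close>
  on \<open>span W\<close> lies in \<open>F\<close>. If \<open>span W\<close> met \<open>F\<close>
  only in 0, then \<open>g\<close> would be injective there and put \<open>card W\<close>
  independent vectors into \<open>span B\<close>.\<close>

lemma ex_nonzero_span_inter_fin_codim: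
  fixes W :: "'a::real_vector set"
  assumes F: "subspace F" and B: "finite B" "\<And>w. w \<in> W \<Longrightarrow> \<exists>b\<in>span B. w - b \<in> F"
    and W: "independent W" "card B < card W"
  shows "\<exists>y\<in>span W \<inter> F. y \<noteq> 0"
proof (rule ccontr)
  assume *: "\<not> ?thesis"
  have trivial: "y = 0" if "y \<in> span W" "y \<in> F" for y
    using * that by blast
  obtain b where b: "b w \<in> span B" "w - b w \<in> F" if "w \<in> W" for w using B(2) by metis
  obtain g where g: "linear g" "\<forall>w\<in>W. g w = b w"
    using linear_independent_extend[OF W(1)] by blast
  have diff: "y - g y \<in> F" if "y \<in> span W" for y
    using that
  proof (induction rule: span_induct_alt)
    case base
    show ?case using F g(1) by (simp add: linear_0 subspace_0)
  next
    case (step c x y)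
    have "c *\<^sub>R x + y - g (c *\<^sub>R x + y) = c *\<^sub>R (x - g x) + (y - g y)"
      using g(1) by (simp add: linear_add linear_scale algebra_simps)
    moreover have "x - g x \<in> F" using step b g(2) by simp
    ultimately show ?case using step F by (simp only: subspace_add subspace_scale)
  qed
  have inj: "inj_on g (span W)"
  proof (rule inj_onI)
    fix x y assume xy: "x \<in> span W" "y \<in> span W" "g x = g y"
    then have "x - y \<in> span W" "g (x - y) = 0" using g(1) by (auto simp: span_diff linear_diff)
    then show "x = y" using trivial[of "x - y"] diff[of "x - y"] by simp
  qed
  have "independent (g ` W)"
    using linear_independent_injective_image[OF g(1) W(1) inj] .
  moreover have "g ` W \<subseteq> span B" using b g(2) by auto
  ultimately have "card (g ` W) \<le> card B" using independent_span_bound[OF B(1)] by blast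
  moreover have "card (g ` W) = card W"
    using inj span_superset by (intro card_image) (rule inj_on_subset)
  ultimately show False using W(2) by simp
qed

section \<open>Unit vectors inside a subspace of finite codimension\<close>

abbreviation unit_seq :: "nat \<Rightarrow> nat \<Rightarrow> real"
  where "unit_seq i \<equiv> (\<lambda>n. if n = i then 1 else 0)"

lemma unit_seq_sums: "(\<lambda>n. \<bar>unit_seq i n\<bar> powr s) sums 1"
  using sums_single[of i "\<lambda>_. 1"] by (rule sums_cong[THEN iffD1, rotated]) auto

lemma unit_seq_mem_ell: "unit_seq i \<in> pts (ell s)"
  using unit_seq_sums unfolding mem_pts_ell by (rule sums_summable)

lemma nrm_unit_seq: "nrm (ell s) (unit_seq i) = 1"
  using sums_unique[OF unit_seq_sums[of i s]] by (simp add: nrm_ell)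

lemma nrm_direct_sum_ell_left:
  assumes "0 < r"
  shows "nrm (direct_sum r (ell s) (ell r)) (a, 0) = nrm (ell s) a"
  using assms by (simp add: nrm_direct_sum nrm_ell powr_powr)

text \<open>The shift \<open>Suc i\<close> keeps coordinate 0 free for the vector at which the
  moduli are attained. Each new vector has entry 1 at coordinate \<open>Suc n\<close>, where all
  earlier ones vanish.\<close>

lemma independent_unit_seq_left:
  "independent ((\<lambda>i. (unit_seq (Suc i), 0 :: nat \<Rightarrow> real)) ` {..<n})"
proof (induction n)
  case (Suc n)
  let ?w = "\<lambda>i. (unit_seq (Suc i), 0 :: nat \<Rightarrow> real)"
  have "subspace {z :: (nat \<Rightarrow> real) \<times> (nat \<Rightarrow> real). fst z (Suc n) = 0}"
    by (auto simp: subspace_def)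
  then have "span (?w ` {..<n}) \<subseteq> {z. fst z (Suc n) = 0}"
    by (intro span_minimal) auto
  then have "?w n \<notin> span (?w ` {..<n})" by auto
  then show ?case
    unfolding lessThan_Suc image_insert using Suc by (rule independent_insertI)
qed (simp add: independent_empty)

text \<open>The dimension count finds a nonzero vector of \<open>F\<close> in the span of shifted
  unit sequences, which is then normalised. It also shows that the unit sphere of \<open>F\<close>
  is nonempty.\<close>

lemma fin_codim_unit_vector:
  assumes r: "1 \<le> r" and s: "1 \<le> s" and F: "fin_codim (direct_sum r (ell s) (ell r)) F"
  obtains a where "(a, 0) \<in> unit_sphere (direct_sum r (ell s) (ell r)) F" "a \<in> pts (ell s)" "a 0 = 0"
proof -
  let ?E = "direct_sum r (ell s) (ell r)"
  interpret E: normed_nspace ?E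
    using r s by (intro normed_nspace_direct_sum normed_nspace_ell)
  let ?w = "\<lambda>i. (unit_seq (Suc i), 0 :: nat \<Rightarrow> real)"
  obtain B where sub: "subspace F" "F \<subseteq> pts ?E" and B: "finite B"
    "\<And>x. x \<in> pts ?E \<Longrightarrow> \<exists>b\<in>span B. x - b \<in> F"
    using F unfolding fin_codim_def by blast
  \<comment> \<open>One vector more than \<open>B\<close> has, as the dimension count
    requires.\<close>
  let ?W = "?w ` {..<Suc (card B)}"
  have "inj_on ?w {..<Suc (card B)}" by (auto simp: inj_on_def fun_eq_iff split: if_splits)
  then have card: "card B < card ?W" by (simp add: card_image)
  have W: "?w i \<in> pts ?E" for i
    using unit_seq_mem_ell by (simp add: mem_pts_direct_sum mem_pts_ell[of 0])
  have "\<exists>b\<in>span B. w - b \<in> F" if "w \<in> ?W" for w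
    using that W B(2) by (elim imageE) simp
  then obtain y where y: "y \<in> span ?W" "y \<in> F" "y \<noteq> 0"
    using ex_nonzero_span_inter_fin_codim[OF sub(1) B(1) _ independent_unit_seq_left card] by blast
  \<comment> \<open>Both constraints are linear, so they pass from the generators to
    \<open>y\<close> and survive the normalisation.\<close>
  have "subspace {z :: (nat \<Rightarrow> real) \<times> (nat \<Rightarrow> real). fst z 0 = 0 \<and> snd z = 0}"
    by (auto simp: subspace_def)
  then have "span ?W \<subseteq> {z. fst z 0 = 0 \<and> snd z = 0}"
    by (intro span_minimal) auto
  then have y0: "fst y 0 = 0" "snd y = 0" using y(1) by auto
  have ypts: "y \<in> pts ?E" using y(2) sub(2) by auto
  then have pos: "nrm ?E y \<noteq> 0" using y(3) E.nrm_eq_0D by blast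
  define c where "c = 1 / nrm ?E y"
  have "c *\<^sub>R y \<in> F" using sub(1) y(2) by (rule subspace_scale)
  moreover have "nrm ?E (c *\<^sub>R y) = 1"
    using pos ypts E.nrm_nonneg[of y] by (simp add: E.nrm_scaleR c_def)
  ultimately have "c *\<^sub>R y \<in> unit_sphere ?E F" by (simp add: unit_sphere_def)
  moreover have "c *\<^sub>R y = (c *\<^sub>R fst y, 0)" using y0 by (simp add: prod_eq_iff)
  moreover have "c *\<^sub>R fst y \<in> pts (ell s)"
    using ypts s by (simp add: mem_pts_direct_sum ell_scaleR)
  ultimately show ?thesis using that[of "c *\<^sub>R fst y"] y0 by simp
qed

section \<open>Tail subspaces and truncation\<close>

definition tail_space :: "((nat \<Rightarrow> real) \<times> (nat \<Rightarrow> real)) nspace \<Rightarrow> nat \<Rightarrow> ((nat \<Rightarrow> real) \<times> (nat \<Rightarrow> real)) set"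
  where "tail_space E n = {z \<in> pts E. \<forall>i<n. fst z i = 0 \<and> snd z i = 0}"

definition trunc :: "nat \<Rightarrow> (nat \<Rightarrow> real) \<Rightarrow> nat \<Rightarrow> real"
  where "trunc n u = (\<lambda>i. if i < n then u i else 0)"

lemma trunc_Suc: "trunc (Suc n) u = trunc n u + u n *\<^sub>R unit_seq n"
  by (auto simp: trunc_def fun_eq_iff less_Suc_eq)

text \<open>Every vector is thus represented, modulo a tail subspace, by an element of a fixed
  finite-dimensional span.\<close>

lemma trunc_mem_span:
  "(trunc n u, trunc n v) \<in> span ((\<lambda>i. (unit_seq i, 0)) ` {..<n} \<union> (\<lambda>i. (0, unit_seq i)) ` {..<n})"
proof (induction n)
  case 0
  then show ?case by (simp add: trunc_def zero_prod_def[symmetric] zero_fun_def[symmetric] span_0)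
next
  case (Suc n)
  let ?B = "\<lambda>n. (\<lambda>i. (unit_seq i, 0)) ` {..<n} \<union> (\<lambda>i. (0, unit_seq i)) ` {..<n}"
  have "(trunc n u, trunc n v) \<in> span (?B (Suc n))"
    using Suc span_mono[of "?B n" "?B (Suc n)"] by fastforce
  moreover have "(unit_seq n, 0) \<in> span (?B (Suc n))" "(0, unit_seq n) \<in> span (?B (Suc n))"
    by (auto intro: span_base)
  ultimately have "(trunc n u, trunc n v) + (u n *\<^sub>R (unit_seq n, 0) + v n *\<^sub>R (0, unit_seq n))
      \<in> span (?B (Suc n))"
    by (intro span_add span_scale)
  also have "(trunc n u, trunc n v) + (u n *\<^sub>R (unit_seq n, 0) + v n *\<^sub>R (0, unit_seq n))
      = (trunc (Suc n) u, trunc (Suc n) v)"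
    unfolding trunc_Suc scaleR_Pair add_Pair scaleR_zero_right add_0_left add_0_right ..
  finally show ?case .
qed

lemma trunc_mem_ell: "trunc n u \<in> pts (ell s)"
  unfolding mem_pts_ell by (rule summable_finite[of "{..<n}"]) (auto simp: trunc_def)

lemma nrm_direct_sum_ge:
  assumes "0 < r" "0 \<le> nrm X (fst z)" "0 \<le> nrm Y (snd z)"
  shows "nrm X (fst z) \<le> nrm (direct_sum r X Y) z" "nrm Y (snd z) \<le> nrm (direct_sum r X Y) z"
proof -
  have "(nrm X (fst z) powr r) powr (1 / r) \<le> nrm (direct_sum r X Y) z"
    "(nrm Y (snd z) powr r) powr (1 / r) \<le> nrm (direct_sum r X Y) z"
    unfolding nrm_direct_sum using assms by (auto intro!: powr_mono2)
  then show "nrm X (fst z) \<le> nrm (direct_sum r X Y) z" "nrm Y (snd z) \<le> nrm (direct_sum r X Y) z"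
    using assms by (auto simp: powr_powr)
qed

text \<open>Closedness holds because coordinates are dominated by the norm. The codimension is
  finite because subtracting its truncation moves a vector into the tail subspace.\<close>

lemma fin_codim_tail_space:
  assumes r: "1 \<le> r" and s: "1 \<le> s"
  defines "E \<equiv> direct_sum r (ell s) (ell r)"
  shows "fin_codim E (tail_space E n)"
proof -
  interpret E: normed_nspace E
    unfolding E_def using r s by (intro normed_nspace_direct_sum normed_nspace_ell)
  have sub: "subspace (tail_space E n)"
    using E.subspace_pts by (auto simp: subspace_def tail_space_def)
  have coord: "\<bar>fst z i\<bar> \<le> nrm E z" "\<bar>snd z i\<bar> \<le> nrm E z" if "z \<in> pts E" for z i
    using that r s abs_nth_le_nrm_ell[of s "fst z" i] abs_nth_le_nrm_ell[of r "snd z" i]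
      nrm_direct_sum_ge[of r "ell s" z "ell r"]
    by (auto simp: E_def mem_pts_direct_sum nrm_ell[of s "fst z"] nrm_ell[of r "snd z"])
  have "closedin (norm_topology E) (tail_space E n)"
    unfolding norm_topology_def E.closedin_metric
  proof (intro conjI allI impI)
    show "tail_space E n \<subseteq> pts E" by (auto simp: tail_space_def)
    fix z assume z: "z \<in> pts E - tail_space E n"
    then obtain i where i: "i < n" "fst z i \<noteq> 0 \<or> snd z i \<noteq> 0" by (auto simp: tail_space_def)
    \<comment> \<open>Vectors of the tail subspace vanish at \<open>i\<close>, so each has distance
      at least \<rho> from \<open>z\<close>. The maximum covers both components, of which only one
      need be nonzero.\<close>
    define \<rho> where "\<rho> = max \<bar>fst z i\<bar> \<bar>snd z i\<bar>"
    have "\<rho> \<le> nrm E (z - w)" if "w \<in> tail_space E n" for w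
    proof -
      have "z - w \<in> pts E" using that z E.subspace_pts by (auto simp: tail_space_def subspace_diff)
      from coord[OF this, of i] show ?thesis using that i by (auto simp: \<rho>_def tail_space_def)
    qed
    then have "disjnt (tail_space E n) (E.mball z \<rho>)"
      by (fastforce simp: disjnt_iff)
    moreover have "\<rho> > 0" using i by (auto simp: \<rho>_def)
    ultimately show "\<exists>r>0. disjnt (tail_space E n) (E.mball z r)" by blast
  qed
  moreover
  let ?B = "(\<lambda>i. (unit_seq i, 0)) ` {..<n} \<union> (\<lambda>i. (0, unit_seq i)) ` {..<n}"
  have "?B \<subseteq> pts E"
    using unit_seq_mem_ell by (auto simp: E_def mem_pts_direct_sum mem_pts_ell[of 0])
  moreover have "\<exists>b\<in>span ?B. z - b \<in> tail_space E n" if "z \<in> pts E" for z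
  proof (rule bexI[OF _ trunc_mem_span])
    have "(trunc n (fst z), trunc n (snd z)) \<in> pts E"
      by (simp add: E_def mem_pts_direct_sum trunc_mem_ell)
    then have "z - (trunc n (fst z), trunc n (snd z)) \<in> pts E"
      using that E.subspace_pts by (simp add: subspace_diff)
    then show "z - (trunc n (fst z), trunc n (snd z)) \<in> tail_space E n"
      by (auto simp: tail_space_def trunc_def)
  qed
  moreover have "finite ?B" "tail_space E n \<subseteq> pts E" by (auto simp: tail_space_def)
  ultimately show ?thesis
    using sub unfolding fin_codim_def by (intro conjI exI[of _ ?B]) simp_all
qed

text \<open>The sequence consists of the remainders of a convergent series.\<close>

lemma nrm_ell_trunc_tendsto:
  assumes s: "0 < s" and u: "u \<in> pts (ell s)"
  shows "(\<lambda>n. nrm (ell s) (u - trunc n u) powr s) \<longlonglongrightarrow> 0"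
proof -
  let ?f = "\<lambda>n. \<bar>u n\<bar> powr s"
  have f: "summable ?f" using u by (simp add: mem_pts_ell)
  have sums: "(\<lambda>i. \<bar>(u - trunc n u) i\<bar> powr s) sums (suminf ?f - sum ?f {..<n})" for n
  proof -
    have "(\<lambda>i. ?f i - (if i \<in> {..<n} then ?f i else 0)) sums (suminf ?f - sum ?f {..<n})"
      using f by (intro sums_diff summable_sums sums_If_finite_set) auto
    also have "(\<lambda>i. ?f i - (if i \<in> {..<n} then ?f i else 0)) = (\<lambda>i. \<bar>(u - trunc n u) i\<bar> powr s)"
      by (auto simp: trunc_def)
    finally show ?thesis .
  qed
  then have "nrm (ell s) (u - trunc n u) powr s = suminf ?f - sum ?f {..<n}" for n
    using s nrm_ell_powr[of s "u - trunc n u"] by (simp add: mem_pts_ell sums_iff)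
  moreover have "(\<lambda>n. suminf ?f - sum ?f {..<n}) \<longlonglongrightarrow> suminf ?f - suminf ?f"
    using f by (intro tendsto_intros summable_LIMSEQ)
  ultimately show ?thesis by simp
qed

lemma approx_disjoint_tail_space:
  assumes r: "1 \<le> r" and s: "1 \<le> s"
  defines "E \<equiv> direct_sum r (ell s) (ell r)"
  assumes x: "x \<in> pts E" and e: "0 < \<epsilon>"
  obtains n x' where "x' \<in> pts E" "nrm E (x - x') < \<epsilon>" "\<And>z. z \<in> tail_space E n \<Longrightarrow> disjoint_supp x' z"
proof -
  \<comment> \<open>The remainders are known for the power \<open>s\<close>, but the direct sum
    takes the power \<open>r\<close> of this norm; hence the outer exponent
    \<open>r / s\<close>.\<close>
  have fst: "(\<lambda>n. (nrm (ell s) (fst x - trunc n (fst x)) powr s) powr (r / s)) \<longlonglongrightarrow> 0"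
    using x r s by (intro tendsto_zero_powrI[OF nrm_ell_trunc_tendsto tendsto_const])
      (auto simp: E_def mem_pts_direct_sum)
  have snd: "(\<lambda>n. nrm (ell r) (snd x - trunc n (snd x)) powr r) \<longlonglongrightarrow> 0"
    using x r by (intro nrm_ell_trunc_tendsto) (auto simp: E_def mem_pts_direct_sum)
  have sum: "(\<lambda>n. (nrm (ell s) (fst x - trunc n (fst x)) powr r +
        nrm (ell r) (snd x - trunc n (snd x)) powr r)) \<longlonglongrightarrow> 0"
    using tendsto_add[OF fst snd] s by (simp add: powr_powr)
  have "(\<lambda>n. nrm E (x - (trunc n (fst x), trunc n (snd x)))) \<longlonglongrightarrow> 0"
    unfolding E_def nrm_direct_sum using r tendsto_zero_powrI[OF sum tendsto_const] by simp
  then have "\<forall>\<^sub>F n in sequentially. nrm E (x - (trunc n (fst x), trunc n (snd x))) < \<epsilon>"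
    using e by (rule order_tendstoD(2))
  then obtain n where n: "nrm E (x - (trunc n (fst x), trunc n (snd x))) < \<epsilon>"
    by (auto simp: eventually_sequentially)
  show ?thesis
  proof
    show "(trunc n (fst x), trunc n (snd x)) \<in> pts E"
      by (simp add: E_def mem_pts_direct_sum trunc_mem_ell)
    show "disjoint_supp (trunc n (fst x), trunc n (snd x)) z" if "z \<in> tail_space E n" for z
      using that by (auto simp: disjoint_supp_def tail_space_def trunc_def)
  qed (rule n)
qed

section \<open>The moduli\<close>

context normed_nspace
begin

lemma nrm_add_scaleR_le:
  assumes "x \<in> pts E" "F \<subseteq> pts E" "y \<in> unit_sphere E F"
  shows "nrm E (x + t *\<^sub>R y) \<le> nrm E x + \<bar>t\<bar>"
  using nrm_triangle[of x "t *\<^sub>R y"] nrm_scaleR[of y t] assms subspace_pts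
  by (auto simp: unit_sphere_def subspace_scale subset_iff)

lemma bdd_above_nrm_add_scaleR:
  assumes "x \<in> pts E" "fin_codim E F"
  shows "bdd_above ((\<lambda>y. nrm E (x + t *\<^sub>R y)) ` unit_sphere E F)"
  using nrm_add_scaleR_le[OF assms(1)] assms(2) by (intro bdd_aboveI2) (auto simp: fin_codim_def)

lemma bdd_below_nrm_add_scaleR:
  "bdd_below ((\<lambda>y. nrm E (x + t *\<^sub>R y)) ` S)"
  by (rule bdd_belowI2[of _ 0]) (rule nrm_nonneg)

text \<open>\<open>approx\<close> bounds \<open>auc_at\<close> from below at every point, and
  \<open>attained\<close> bounds it from above at \<open>e\<close>. Since suprema and infima are of
  real numbers, nonemptiness and boundedness need proof; \<open>attained\<close> also supplies the
  nonempty spheres.\<close>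

lemma auc_modulus_eqI:
  assumes approx: "\<And>x \<epsilon>. x \<in> unit_sphere E (pts E) \<Longrightarrow> 0 < \<epsilon> \<Longrightarrow>
      \<exists>F. fin_codim E F \<and> (\<forall>y\<in>unit_sphere E F. c - \<epsilon> \<le> nrm E (x + t *\<^sub>R y))"
    and e: "e \<in> unit_sphere E (pts E)"
    and attained: "\<And>F. fin_codim E F \<Longrightarrow> \<exists>y\<in>unit_sphere E F. nrm E (e + t *\<^sub>R y) = c"
  shows "auc_modulus E t = c - 1"
proof -
  have ge: "c - 1 \<le> auc_at E t x" if x: "x \<in> unit_sphere E (pts E)" for x
  proof (rule field_le_epsilon)
    fix \<epsilon> :: real assume "0 < \<epsilon>"
    then obtain F where F: "fin_codim E F" "\<forall>y\<in>unit_sphere E F. c - \<epsilon> \<le> nrm E (x + t *\<^sub>R y)"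
      using approx x by blast
    let ?I = "\<lambda>F. INF y\<in>unit_sphere E F. nrm E (x + t *\<^sub>R y)"
    have "c - \<epsilon> \<le> ?I F" using F attained[OF F(1)] by (intro cINF_greatest) auto
    also have "\<dots> \<le> (SUP F\<in>{F. fin_codim E F}. ?I F)"
    proof (rule cSUP_upper)
      show "bdd_above (?I ` {F. fin_codim E F})"
      proof (rule bdd_aboveI2)
        fix G assume "G \<in> {F. fin_codim E F}"
        then have G: "fin_codim E G" by simp
        then obtain y where y: "y \<in> unit_sphere E G" using attained by blast
        have "?I G \<le> nrm E (x + t *\<^sub>R y)" by (rule cINF_lower[OF bdd_below_nrm_add_scaleR y])
        also have "\<dots> \<le> nrm E x + \<bar>t\<bar>"
          using x y G by (intro nrm_add_scaleR_le) (auto simp: fin_codim_def unit_sphere_def)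
        finally show "?I G \<le> nrm E x + \<bar>t\<bar>" .
      qed
    qed (use F in simp)
    finally show "c - 1 \<le> auc_at E t x + \<epsilon>" by (simp add: auc_at_def)
  qed
  \<comment> \<open>The value 1 is arbitrary; only the existence of a subspace of finite codimension
    matters.\<close>
  obtain F0 where F0: "fin_codim E F0" using approx[OF e, of 1] by auto
  have "auc_at E t e \<le> c - 1"
    unfolding auc_at_def
  proof (intro diff_right_mono cSUP_least)
    show "{F. fin_codim E F} \<noteq> {}" using F0 by blast
    fix G assume "G \<in> {F. fin_codim E F}"
    then obtain y where y: "y \<in> unit_sphere E G" "nrm E (e + t *\<^sub>R y) = c" using attained by blast
    then show "(INF y\<in>unit_sphere E G. nrm E (e + t *\<^sub>R y)) \<le> c"
      using cINF_lower[OF bdd_below_nrm_add_scaleR y(1)] by metis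
  qed
  moreover have "auc_modulus E t \<le> auc_at E t e"
    unfolding auc_modulus_def by (rule cINF_lower[OF bdd_belowI2 e]) (rule ge)
  moreover have "c - 1 \<le> auc_modulus E t"
    unfolding auc_modulus_def using e ge by (intro cINF_greatest) auto
  ultimately show ?thesis by simp
qed

text \<open>Dual to \<open>auc_modulus_eqI\<close>: \<open>approx\<close> now bounds
  \<open>aus_at\<close> from above everywhere and \<open>attained\<close> bounds it from below at
  \<open>e\<close>. The inner suprema are bounded by the triangle inequality, and the outer infimum
  is bounded below by 0.\<close>

lemma aus_modulus_eqI:
  assumes approx: "\<And>x \<epsilon>. x \<in> unit_sphere E (pts E) \<Longrightarrow> 0 < \<epsilon> \<Longrightarrow>
      \<exists>F. fin_codim E F \<and> (\<forall>y\<in>unit_sphere E F. nrm E (x + t *\<^sub>R y) \<le> c + \<epsilon>)"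
    and e: "e \<in> unit_sphere E (pts E)"
    and attained: "\<And>F. fin_codim E F \<Longrightarrow> \<exists>y\<in>unit_sphere E F. nrm E (e + t *\<^sub>R y) = c"
  shows "aus_modulus E t = c - 1"
proof -
  have le: "aus_at E t x \<le> c - 1" if x: "x \<in> unit_sphere E (pts E)" for x
  proof (rule field_le_epsilon)
    fix \<epsilon> :: real assume "0 < \<epsilon>"
    then obtain F where F: "fin_codim E F" "\<forall>y\<in>unit_sphere E F. nrm E (x + t *\<^sub>R y) \<le> c + \<epsilon>"
      using approx x by blast
    let ?S = "\<lambda>F. SUP y\<in>unit_sphere E F. nrm E (x + t *\<^sub>R y)"
    have "(INF F\<in>{F. fin_codim E F}. ?S F) \<le> ?S F"
    proof (rule cINF_lower)
      show "bdd_below (?S ` {F. fin_codim E F})"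
      proof (rule bdd_belowI2)
        fix G assume "G \<in> {F. fin_codim E F}"
        then have G: "fin_codim E G" by simp
        then obtain y where y: "y \<in> unit_sphere E G" using attained by blast
        have "0 \<le> nrm E (x + t *\<^sub>R y)" by (rule nrm_nonneg)
        also have "\<dots> \<le> ?S G"
          using x y G by (intro cSUP_upper bdd_above_nrm_add_scaleR) (auto simp: unit_sphere_def)
        finally show "0 \<le> ?S G" .
      qed
    qed (use F in simp)
    also have "?S F \<le> c + \<epsilon>" using F attained[OF F(1)] by (intro cSUP_least) auto
    finally show "aus_at E t x \<le> c - 1 + \<epsilon>" by (simp add: aus_at_def)
  qed
  obtain F0 where F0: "fin_codim E F0" using approx[OF e, of 1] by auto
  have "c - 1 \<le> aus_at E t e"
    unfolding aus_at_def
  proof (intro diff_right_mono cINF_greatest)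
    show "{F. fin_codim E F} \<noteq> {}" using F0 by blast
    fix G assume "G \<in> {F. fin_codim E F}"
    then have G: "fin_codim E G" by simp
    then obtain y where y: "y \<in> unit_sphere E G" "nrm E (e + t *\<^sub>R y) = c" using attained by blast
    have "bdd_above ((\<lambda>y. nrm E (e + t *\<^sub>R y)) ` unit_sphere E G)"
      using e G by (intro bdd_above_nrm_add_scaleR) (auto simp: unit_sphere_def)
    then show "c \<le> (SUP y\<in>unit_sphere E G. nrm E (e + t *\<^sub>R y))"
      using cSUP_upper[OF y(1)] y(2) by metis
  qed
  moreover have "aus_at E t e \<le> aus_modulus E t"
    unfolding aus_modulus_def by (rule cSUP_upper[OF e bdd_aboveI2]) (rule le)
  moreover have "aus_modulus E t \<le> c - 1"
    unfolding aus_modulus_def using e le by (intro cSUP_least) auto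
  ultimately show ?thesis by simp
qed

end

section \<open>The common value for the two direct sums\<close>

lemma unit_seq_left_unit_sphere:
  fixes r s :: real
  defines "E \<equiv> direct_sum r (ell s) (ell r)"
  assumes "0 < r"
  shows "(unit_seq 0, 0) \<in> unit_sphere E (pts E)"
  unfolding E_def using assms(2) unit_seq_mem_ell nrm_unit_seq
  by (simp add: unit_sphere_def mem_pts_direct_sum nrm_direct_sum_ell_left mem_pts_ell[of 0])

text \<open>The vector \<open>a\<close> vanishes at 0, so \<open>unit_seq 0\<close> and
  \<open>t *\<^sub>R a\<close> are disjoint and their \<open>s\<close>-th powers 1 and
  \<open>t powr s\<close> add. With zero second components the exponent \<open>r\<close> disappears,
  which is why both direct sums give the same value.\<close>

lemma ex_unit_vector_nrm_eq:
  assumes r: "1 \<le> r" and s: "1 \<le> s" and t: "0 < t"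
  defines "E \<equiv> direct_sum r (ell s) (ell r)"
  assumes F: "fin_codim E F"
  shows "\<exists>y\<in>unit_sphere E F. nrm E ((unit_seq 0, 0) + t *\<^sub>R y) = (1 + t powr s) powr (1 / s)"
proof -
  obtain a where a: "(a, 0) \<in> unit_sphere E F" "a \<in> pts (ell s)" "a 0 = 0"
    using fin_codim_unit_vector[OF r s] F unfolding E_def by metis
  have "nrm (ell s) (t *\<^sub>R a) = t"
    using a r s t by (simp add: E_def unit_sphere_def nrm_direct_sum_ell_left ell_scaleR)
  moreover have "nrm (ell s) (unit_seq 0 + t *\<^sub>R a) powr s =
      nrm (ell s) (unit_seq 0) powr s + nrm (ell s) (t *\<^sub>R a) powr s"
    using a s by (intro nrm_ell_add_disjoint unit_seq_mem_ell ell_scaleR) auto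
  ultimately have "(nrm (ell s) (unit_seq 0 + t *\<^sub>R a) powr s) powr (1 / s) = (1 + t powr s) powr (1 / s)"
    by (simp add: nrm_unit_seq)
  then have "nrm (ell s) (unit_seq 0 + t *\<^sub>R a) = (1 + t powr s) powr (1 / s)"
    using s normed_nspace.nrm_nonneg[OF normed_nspace_ell[OF s]] by (simp add: powr_powr)
  moreover have "(unit_seq 0, 0) + t *\<^sub>R (a, 0 :: nat \<Rightarrow> real) = (unit_seq 0 + t *\<^sub>R a, 0)"
    by simp
  ultimately show ?thesis
    using a(1) r by (intro bexI[of _ "(a, 0)"]) (simp_all add: E_def nrm_direct_sum_ell_left)
qed

text \<open>Minkowski's inequality for \<open>(a, t) + (\<epsilon>, 0)\<close>. It pays for the
  difference between the norm of a unit vector and that of its finitely supported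
  approximation.\<close>

lemma powr_add_perturb_le:
  fixes a b t s \<epsilon> :: real
  assumes "1 \<le> s" "0 \<le> a" "0 \<le> t" "0 \<le> \<epsilon>" "0 \<le> b" "b \<le> a + \<epsilon>"
  shows "(b powr s + t powr s) powr (1 / s) \<le> (a powr s + t powr s) powr (1 / s) + \<epsilon>"
proof -
  have "(b powr s + t powr s) powr (1 / s) \<le> ((a + \<epsilon>) powr s + (t + 0) powr s) powr (1 / s)"
    using assms by (intro powr_mono2 add_mono) auto
  also have "\<dots> \<le> (a powr s + t powr s) powr (1 / s) + (\<epsilon> powr s + 0 powr s) powr (1 / s)"
    using assms by (intro minkowski_two) auto
  finally show ?thesis using assms by (simp add: powr_powr)
qed

lemma auc_modulus_direct_sum_ell:
  assumes p: "1 \<le> p" "p \<le> s" and t: "0 < t"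
  shows "auc_modulus (direct_sum p (ell s) (ell p)) t = (1 + t powr s) powr (1 / s) - 1"
proof -
  define E where "E = direct_sum p (ell s) (ell p)"
  have s: "1 \<le> s" and p0: "0 < p" using p by auto
  interpret E: normed_nspace E
    unfolding E_def using p s by (intro normed_nspace_direct_sum normed_nspace_ell)
  have "auc_modulus E t = (1 + t powr s) powr (1 / s) - 1"
  proof (rule E.auc_modulus_eqI)
    show "(unit_seq 0, 0) \<in> unit_sphere E (pts E)"
      unfolding E_def by (rule unit_seq_left_unit_sphere[OF p0])
    show "\<exists>y\<in>unit_sphere E F. nrm E ((unit_seq 0, 0) + t *\<^sub>R y) = (1 + t powr s) powr (1 / s)"
      if "fin_codim E F" for F
      using ex_unit_vector_nrm_eq[OF p(1) s t] that unfolding E_def .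
    fix x and \<epsilon> :: real assume x: "x \<in> unit_sphere E (pts E)" and \<epsilon>: "0 < \<epsilon>"
    then have xE: "x \<in> pts E" "nrm E x = 1" by (auto simp: unit_sphere_def)
    \<comment> \<open>One half of \<epsilon> covers the gap between \<open>nrm E x'\<close> and 1,
      the other the replacement of \<open>x\<close> by \<open>x'\<close> in the sum.\<close>
    obtain n x' where x': "x' \<in> pts E" "nrm E (x - x') < \<epsilon> / 2"
      "\<And>z. z \<in> tail_space E n \<Longrightarrow> disjoint_supp x' z"
      using approx_disjoint_tail_space[OF p(1) s, of x "\<epsilon> / 2"] xE \<epsilon> unfolding E_def
      by (metis half_gt_zero)
    have "(1 + t powr s) powr (1 / s) - \<epsilon> \<le> nrm E (x + t *\<^sub>R y)"
      if y: "y \<in> unit_sphere E (tail_space E n)" for y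
    proof -
      have yT: "t *\<^sub>R y \<in> tail_space E n" and yE: "t *\<^sub>R y \<in> pts E" and ny: "nrm E (t *\<^sub>R y) = t"
        using y t E.subspace_pts
        by (auto simp: unit_sphere_def tail_space_def subspace_scale E.nrm_scaleR)
      have "(1 powr s + t powr s) powr (1 / s) \<le> (nrm E x' powr s + t powr s) powr (1 / s) + \<epsilon> / 2"
        using E.nrm_diff_le[of x x'] xE x' s t \<epsilon> E.nrm_nonneg[of x']
        by (intro powr_add_perturb_le) auto
      \<comment> \<open>Scaling by \<open>t\<close> stays inside the tail subspace, so
        \<open>x'\<close> and \<open>t *\<^sub>R y\<close> are disjoint.\<close>
      also have "(nrm E x' powr s + t powr s) powr (1 / s) \<le> nrm E (x' + t *\<^sub>R y)"
        using nrm_add_disjoint_lower[OF p0 p(2) x'(3)[OF yT]] x'(1) yE ny by (simp add: E_def)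
      also have "nrm E (x' + t *\<^sub>R y) \<le> nrm E (x + t *\<^sub>R y) + nrm E (x' - x)"
        using E.nrm_diff_le[of "x' + t *\<^sub>R y" "x + t *\<^sub>R y"] x' xE yE E.subspace_pts
        by (simp add: subspace_add)
      also have "nrm E (x' - x) \<le> \<epsilon> / 2"
        using x' xE E.nrm_minus_commute by fastforce
      finally show ?thesis by simp
    qed
    then show "\<exists>F. fin_codim E F \<and>
        (\<forall>y\<in>unit_sphere E F. (1 + t powr s) powr (1 / s) - \<epsilon> \<le> nrm E (x + t *\<^sub>R y))"
      using fin_codim_tail_space[OF p(1) s] unfolding E_def by blast
  qed
  then show ?thesis by (simp add: E_def)
qed

lemma aus_modulus_direct_sum_ell:
  assumes s: "1 \<le> s" "s \<le> q" and t: "0 < t"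
  shows "aus_modulus (direct_sum q (ell s) (ell q)) t = (1 + t powr s) powr (1 / s) - 1"
proof -
  define E where "E = direct_sum q (ell s) (ell q)"
  have q: "1 \<le> q" and s0: "0 < s" and q0: "0 < q" using s by auto
  interpret E: normed_nspace E
    unfolding E_def using q s by (intro normed_nspace_direct_sum normed_nspace_ell)
  have "aus_modulus E t = (1 + t powr s) powr (1 / s) - 1"
  proof (rule E.aus_modulus_eqI)
    show "(unit_seq 0, 0) \<in> unit_sphere E (pts E)"
      unfolding E_def by (rule unit_seq_left_unit_sphere[OF q0])
    show "\<exists>y\<in>unit_sphere E F. nrm E ((unit_seq 0, 0) + t *\<^sub>R y) = (1 + t powr s) powr (1 / s)"
      if "fin_codim E F" for F
      using ex_unit_vector_nrm_eq[OF q s(1) t] that unfolding E_def .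
    fix x and \<epsilon> :: real assume x: "x \<in> unit_sphere E (pts E)" and \<epsilon>: "0 < \<epsilon>"
    then have xE: "x \<in> pts E" "nrm E x = 1" by (auto simp: unit_sphere_def)
    \<comment> \<open>\<epsilon> is again split between replacing \<open>x\<close> by
      \<open>x'\<close> in the sum and comparing \<open>nrm E x'\<close> with 1.\<close>
    obtain n x' where x': "x' \<in> pts E" "nrm E (x - x') < \<epsilon> / 2"
      "\<And>z. z \<in> tail_space E n \<Longrightarrow> disjoint_supp x' z"
      using approx_disjoint_tail_space[OF q s(1), of x "\<epsilon> / 2"] xE \<epsilon> unfolding E_def
      by (metis half_gt_zero)
    have diff: "nrm E (x' - x) \<le> \<epsilon> / 2"
      using x' xE E.nrm_minus_commute by fastforce
    have "nrm E (x + t *\<^sub>R y) \<le> (1 + t powr s) powr (1 / s) + \<epsilon>"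
      if y: "y \<in> unit_sphere E (tail_space E n)" for y
    proof -
      have yT: "t *\<^sub>R y \<in> tail_space E n" and yE: "t *\<^sub>R y \<in> pts E" and ny: "nrm E (t *\<^sub>R y) = t"
        using y t E.subspace_pts
        by (auto simp: unit_sphere_def tail_space_def subspace_scale E.nrm_scaleR)
      have "nrm E (x + t *\<^sub>R y) \<le> nrm E (x' + t *\<^sub>R y) + nrm E (x - x')"
        using E.nrm_diff_le[of "x + t *\<^sub>R y" "x' + t *\<^sub>R y"] x' xE yE E.subspace_pts
        by (simp add: subspace_add)
      also have "nrm E (x' + t *\<^sub>R y) \<le> (nrm E x' powr s + t powr s) powr (1 / s)"
        using nrm_add_disjoint_upper[OF s0 s(2) x'(3)[OF yT]] x'(1) yE ny by (simp add: E_def)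
      also have "\<dots> \<le> (1 powr s + t powr s) powr (1 / s) + \<epsilon> / 2"
        using E.nrm_diff_le[of x' x] xE x' diff s t \<epsilon> E.nrm_nonneg[of x']
        by (intro powr_add_perturb_le) auto
      finally show ?thesis using x'(2) by simp
    qed
    then show "\<exists>F. fin_codim E F \<and>
        (\<forall>y\<in>unit_sphere E F. nrm E (x + t *\<^sub>R y) \<le> (1 + t powr s) powr (1 / s) + \<epsilon>)"
      using fin_codim_tail_space[OF q s(1)] unfolding E_def by blast
  qed
  then show ?thesis by (simp add: E_def)
qed

theorem theorem2p12:
  fixes p s q :: real
  assumes "1 < p" and "p \<le> s" and "s \<le> q"
  shows "(\<forall>t>0. auc_modulus (direct_sum p (ell s) (ell p)) t = (1 + t powr s) powr (1 / s) - 1 \<and>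
                aus_modulus (direct_sum q (ell s) (ell q)) t = (1 + t powr s) powr (1 / s) - 1) \<and>
         (\<forall>t>1. aus_modulus (direct_sum q (ell s) (ell q)) t > t - 1)"
proof (intro conjI allI impI)
  fix t :: real assume "0 < t"
  then show "auc_modulus (direct_sum p (ell s) (ell p)) t = (1 + t powr s) powr (1 / s) - 1"
    and "aus_modulus (direct_sum q (ell s) (ell q)) t = (1 + t powr s) powr (1 / s) - 1"
    using assms by (simp_all add: auc_modulus_direct_sum_ell aus_modulus_direct_sum_ell)
next
  fix t :: real assume t: "1 < t"
  have "t = (t powr s) powr (1 / s)" using assms t by (simp add: powr_powr)
  also have "\<dots> < (1 + t powr s) powr (1 / s)" using assms by (intro powr_less_mono2) auto
  finally show "aus_modulus (direct_sum q (ell s) (ell q)) t > t - 1"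
    using assms t by (simp add: aus_modulus_direct_sum_ell)
qed

end
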